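(* Consider the two-state Markov chain with state space $\{1,2\}$ and transition matrix $P=\begin{bmatrix} p_{11} & p_{12} \\ p_{21} & p_{22} \end{bmatrix}=\begin{bmatrix} 1-a & a \\ b & 1-b \end{bmatrix}$, $0\le a\le 1$, $0\le b\le 1$, and let $d=1-a-b$. If $-1\le d<1$, then the distribution $f_{1n}=P\{T_1^{(0)}=n\mid X_0=1\}$ of the mixing time $T_1^{(0)}$ is given by $$f_{10}=\pi_1,\qquad f_{1n}=\pi_2p_{12}p_{11}^{n-1}\quad(n\ge1),$$ and the distribution $g_{1n}=P\{T_1^{(1)}=n\mid X_0=1\}$ of the mixing time $T_1^{(1)}$ is given by $$g_{10}=0,\qquad g_{11}=\pi_1p_{11}+\pi_2p_{12},\qquad g_{1n}=\pi_1(p_{11}p_{22}-d)p_{22}^{n-2}+\pi_2p_{12}p_{11}^{n-1}\quad(n\ge2),$$ where $\{\pi_j\}$ is the stationary distribution $\pi_1=\dfrac{b}{1-d}$, $\pi_2=\dfrac{a}{1-d}$.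
   Context: The mixing variable $M$ is a random variable, independent of the chain, with $P[M=j]=\pi_j$ for $j\in\{1,2\}$. Given $X_0=1$, $T_1^{(0)}=\min\{n\ge 0: X_n=M\}$ and $T_1^{(1)}=\min\{n\ge 1: X_n=M\}$. Convention: $0^0=1$. *)

theory Defs
  imports "HOL-Probability.Probability"
begin

definition stochastic_matrix :: "real^'s^'s \<Rightarrow> bool" where
  "stochastic_matrix P \<longleftrightarrow> (\<forall>i j. 0 \<le> P $ i $ j) \<and> (\<forall>i. (\<Sum>j\<in>UNIV. P $ i $ j) = 1)"

text \<open>Time-homogeneous chains with state space the finite type \<^typ>\<open>'s\<close> and arbitrary initial law.
  The Markov property is only required for histories of positive probability, since otherwise
  the conditional probability is \<open>0\<close> by the division convention.\<close>

definition markov_chain :: "'w measure \<Rightarrow> real^'s^'s \<Rightarrow> (nat \<Rightarrow> 'w \<Rightarrow> 's) \<Rightarrow> bool" where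
  "markov_chain \<Omega> P X \<longleftrightarrow>
     prob_space \<Omega> \<and>
     stochastic_matrix P \<and>
     (\<forall>n. X n \<in> measurable \<Omega> (count_space UNIV)) \<and>
     (\<forall>n i j. \<P>(\<omega> in \<Omega>. \<forall>k\<le>n. X k \<omega> = i k) > 0 \<longrightarrow>
        \<P>(\<omega> in \<Omega>. X (Suc n) \<omega> = j \<bar> \<forall>k\<le>n. X k \<omega> = i k) = P $ i n $ j)"

definition stationary_distribution :: "real^'s^'s \<Rightarrow> real^'s \<Rightarrow> bool" where
  "stationary_distribution P \<pi> \<longleftrightarrow>
     (\<forall>j. 0 \<le> \<pi> $ j) \<and> (\<Sum>j\<in>UNIV. \<pi> $ j) = 1 \<and> \<pi> v* P = \<pi>"

text \<open>Independence of the whole chain is independence of the sigma-algebra generated by \<open>M\<close> from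
  that generated by the path map; the library's \<open>indep_var\<close> does not apply directly because it
  needs both variables to take values in the same type.\<close>

definition mixing_variable ::
  "'w measure \<Rightarrow> real^'s \<Rightarrow> (nat \<Rightarrow> 'w \<Rightarrow> 's) \<Rightarrow> ('w \<Rightarrow> 's) \<Rightarrow> bool" where
  "mixing_variable \<Omega> \<pi> X M \<longleftrightarrow>
     M \<in> measurable \<Omega> (count_space UNIV) \<and>
     (\<forall>j. \<P>(\<omega> in \<Omega>. M \<omega> = j) = \<pi> $ j) \<and>
     prob_space.indep_set \<Omega>
       (sets (vimage_algebra (space \<Omega>) M (count_space UNIV)))
       (sets (vimage_algebra (space \<Omega>) (\<lambda>\<omega> n. X n \<omega>) (\<Pi>\<^sub>M n\<in>UNIV. count_space UNIV)))"

text \<open>\<open>mixing_time k X M\<close> is the least \<open>n \<ge> k\<close> with \<open>X\<^sub>n = M\<close>, and \<open>\<infinity>\<close> if there is none.\<close>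

definition mixing_time :: "nat \<Rightarrow> (nat \<Rightarrow> 'w \<Rightarrow> 's) \<Rightarrow> ('w \<Rightarrow> 's) \<Rightarrow> 'w \<Rightarrow> enat" where
  "mixing_time k X M \<omega> = (INF n\<in>{n. k \<le> n \<and> X n \<omega> = M \<omega>}. enat n)"

end

theory Submission
  imports Defs
begin

text \<open>With two states, the values of \<open>M\<close>, \<open>X 0\<close> and the mixing time determine the whole path up to that
  time: before hitting \<open>M\<close> the chain can only sit in the other state. So each event in question is a
  union of at most two cylinders \<open>{M = j, X\<^sub>0 = i\<^sub>0, \<dots>, X\<^sub>n = i\<^sub>n}\<close>, whose conditional probability given
  \<open>X 0\<close> is \<open>\<pi>\<^sub>j\<close> times a product of transition probabilities.\<close>

text \<open>Each further coordinate multiplies the probability by one conditional probability, which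
  the Markov property evaluates; the initial law is left as a factor, to be cancelled by
  conditioning on \<open>X 0\<close>.\<close>

lemma markov_chain_path_prob:
  assumes "markov_chain \<Omega> P X"
  shows "\<P>(\<omega> in \<Omega>. \<forall>k\<le>n. X k \<omega> = i k) =
    \<P>(\<omega> in \<Omega>. X 0 \<omega> = i 0) * (\<Prod>k<n. P $ i k $ i (Suc k))"
proof (induction n)
  case 0
  show ?case by simp
next
  case (Suc n)
  interpret prob_space \<Omega> using assms by (simp add: markov_chain_def)
  have [measurable]: "X k \<in> measurable \<Omega> (count_space UNIV)" for k
    using assms by (simp add: markov_chain_def)
  let ?A = "\<lambda>\<omega>. \<forall>k\<le>n. X k \<omega> = i k"
  have split: "(\<forall>k\<le>Suc n. X k \<omega> = i k) \<longleftrightarrow> X (Suc n) \<omega> = i (Suc n) \<and> ?A \<omega>" for \<omega>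
    by (auto simp: le_Suc_eq)
  have "\<P>(\<omega> in \<Omega>. X (Suc n) \<omega> = i (Suc n) \<and> ?A \<omega>) =
      \<P>(\<omega> in \<Omega>. ?A \<omega>) * P $ i n $ i (Suc n)"
  proof (cases "\<P>(\<omega> in \<Omega>. ?A \<omega>) > 0")
    case True
    then have "\<P>(\<omega> in \<Omega>. X (Suc n) \<omega> = i (Suc n) \<bar> ?A \<omega>) = P $ i n $ i (Suc n)"
      using assms by (simp add: markov_chain_def)
    with True show ?thesis by (simp add: cond_prob_def field_simps)
  next
    case False
    \<comment> \<open>The Markov property is silent on a null history, but there both sides vanish:
      the longer path is a subevent of the history.\<close>
    have "\<P>(\<omega> in \<Omega>. X (Suc n) \<omega> = i (Suc n) \<and> ?A \<omega>) \<le> \<P>(\<omega> in \<Omega>. ?A \<omega>)"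
      by (intro finite_measure_mono) auto
    with False show ?thesis
      by (smt (verit) measure_nonneg mult_eq_0_iff)
  qed
  with Suc show ?case by (simp only: split) simp
qed

text \<open>A cylinder constrains only finitely many coordinates, so it is the preimage of a
  measurable set under the path map and lies in the sigma-algebra from which \<open>M\<close> is
  independent.\<close>

lemma mixing_variable_path_prob:
  assumes "prob_space \<Omega>" "mixing_variable \<Omega> \<pi> X M"
  shows "\<P>(\<omega> in \<Omega>. M \<omega> = j \<and> (\<forall>k\<le>n. X k \<omega> = i k)) =
    \<pi> $ j * \<P>(\<omega> in \<Omega>. \<forall>k\<le>n. X k \<omega> = i k)"
proof -
  interpret prob_space \<Omega> by fact
  let ?A = "{\<omega>\<in>space \<Omega>. M \<omega> = j}" and ?B = "{\<omega>\<in>space \<Omega>. \<forall>k\<le>n. X k \<omega> = i k}"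
  let ?N = "\<Pi>\<^sub>M n\<in>UNIV. count_space (UNIV :: 'b set)"
  have "?A = M -` {j} \<inter> space \<Omega>" by auto
  then have A: "?A \<in> sets (vimage_algebra (space \<Omega>) M (count_space UNIV))"
    by (simp add: in_vimage_algebra)
  have "{x \<in> space ?N. \<forall>k\<le>n. x k = i k} \<in> sets ?N"
    by measurable
  moreover have "?B = (\<lambda>\<omega> n. X n \<omega>) -` {x \<in> space ?N. \<forall>k\<le>n. x k = i k} \<inter> space \<Omega>"
    by (auto simp: space_PiM)
  ultimately have B: "?B \<in> sets (vimage_algebra (space \<Omega>) (\<lambda>\<omega> n. X n \<omega>) ?N)"
    by (simp only: in_vimage_algebra)
  have "prob (?A \<inter> ?B) = prob ?A * prob ?B"
    using indep_setD[OF _ A B] assms(2) unfolding mixing_variable_def by blast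
  moreover have "?A \<inter> ?B = {\<omega>\<in>space \<Omega>. M \<omega> = j \<and> (\<forall>k\<le>n. X k \<omega> = i k)}"
    by auto
  ultimately show ?thesis
    using assms(2) by (simp add: mixing_variable_def)
qed

text \<open>Replaces the infimum by a first-hitting condition, the form in which paths can be read
  off.\<close>

lemma mixing_time_eq_enat_iff:
  "mixing_time k X M \<omega> = enat n \<longleftrightarrow>
    k \<le> n \<and> X n \<omega> = M \<omega> \<and> (\<forall>m. k \<le> m \<and> m < n \<longrightarrow> X m \<omega> \<noteq> M \<omega>)"
proof -
  let ?S = "{n. k \<le> n \<and> X n \<omega> = M \<omega>}"
  have "mixing_time k X M \<omega> = enat n \<longleftrightarrow> n \<in> ?S \<and> (\<forall>m\<in>?S. n \<le> m)"
  proof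
    assume eq: "mixing_time k X M \<omega> = enat n"
    \<comment> \<open>An empty infimum is the top element \<infinity>, not a finite time. A nonempty
      one is attained, since \<open>enat\<close> is well-ordered.\<close>
    have "?S \<noteq> {}"
    proof
      assume "?S = {}"
      with eq show False by (simp add: mixing_time_def top_enat_def)
    qed
    then obtain m where "enat m \<in> enat ` ?S" by blast
    then have "Inf (enat ` ?S) \<in> enat ` ?S"
      by (rule wellorder_InfI)
    with eq have "n \<in> ?S" by (auto simp: mixing_time_def)
    moreover have "n \<le> m" if "m \<in> ?S" for m
      using INF_lower[OF that, of enat] eq by (simp add: mixing_time_def)
    ultimately show "n \<in> ?S \<and> (\<forall>m\<in>?S. n \<le> m)" by blast
  next
    assume "n \<in> ?S \<and> (\<forall>m\<in>?S. n \<le> m)"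
    then show "mixing_time k X M \<omega> = enat n"
      unfolding mixing_time_def by (intro antisym INF_greatest) (auto intro: INF_lower2)
  qed
  then show ?thesis by (auto simp: not_less[symmetric])
qed

text \<open>With total mass 1, both balance equations reduce to the single relation
  \<open>?x * (a + b) = b\<close>; positivity of \<open>a + b\<close> makes it uniquely solvable,
  with a nonnegative solution.\<close>

lemma stationary_distribution_two_state:
  fixes P :: "real^2^2" and \<rho> :: "real^2"
  assumes "0 \<le> a" "0 \<le> b" "a + b > 0" "P = vector [vector [1 - a, a], vector [b, 1 - b]]"
  shows "stationary_distribution P \<rho> \<longleftrightarrow> \<rho> = vector [b / (a + b), a / (a + b)]"
proof -
  let ?x = "\<rho> $ 1" and ?y = "\<rho> $ 2"
  have "stationary_distribution P \<rho> \<longleftrightarrow>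
      0 \<le> ?x \<and> 0 \<le> ?y \<and> ?x + ?y = 1 \<and> (1 - a) * ?x + b * ?y = ?x \<and> a * ?x + (1 - b) * ?y = ?y"
    by (simp add: stationary_distribution_def assms(4) vector_matrix_mult_def vec_eq_iff
        forall_2 sum_2 mult.commute)
  also have "\<dots> \<longleftrightarrow> ?x * (a + b) = b \<and> ?y * (a + b) = a"
  proof
    assume *: "0 \<le> ?x \<and> 0 \<le> ?y \<and> ?x + ?y = 1 \<and> (1 - a) * ?x + b * ?y = ?x
      \<and> a * ?x + (1 - b) * ?y = ?y"
    then have y: "?y = 1 - ?x" by simp
    have "?x * (a + b) = b"
      using * unfolding y by (simp add: algebra_simps)
    then show "?x * (a + b) = b \<and> ?y * (a + b) = a"
      unfolding y by (simp add: algebra_simps)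
  next
    assume "?x * (a + b) = b \<and> ?y * (a + b) = a"
    then have "?x = b / (a + b)" "?y = a / (a + b)"
      using assms(3) by (simp_all add: field_simps)
    then show "0 \<le> ?x \<and> 0 \<le> ?y \<and> ?x + ?y = 1 \<and> (1 - a) * ?x + b * ?y = ?x
      \<and> a * ?x + (1 - b) * ?y = ?y"
      using assms by (simp add: add_divide_distrib[symmetric]) (simp add: field_simps)
  qed
  also have "\<dots> \<longleftrightarrow> \<rho> = vector [b / (a + b), a / (a + b)]"
    using assms(3) by (simp add: vec_eq_iff forall_2 eq_divide_eq)
  finally show ?thesis .
qed

theorem theorem3p2:
  fixes \<Omega> :: "'w measure" and X :: "nat \<Rightarrow> 'w \<Rightarrow> 2" and M :: "'w \<Rightarrow> 2"
    and P :: "real^2^2" and \<pi> :: "real^2" and a b d :: real and f g :: "nat \<Rightarrow> real"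
  assumes "0 \<le> a" "a \<le> 1" "0 \<le> b" "b \<le> 1"
    and "P = vector [vector [1 - a, a], vector [b, 1 - b]]"
    and "d = 1 - a - b" "-1 \<le> d" "d < 1"
    and "markov_chain \<Omega> P X"
    and "stationary_distribution P \<pi>"
    and "mixing_variable \<Omega> \<pi> X M"
    and "\<P>(\<omega> in \<Omega>. X 0 \<omega> = 1) > 0"
    and "\<And>n. f n = \<P>(\<omega> in \<Omega>. mixing_time 0 X M \<omega> = enat n \<bar> X 0 \<omega> = 1)"
    and "\<And>n. g n = \<P>(\<omega> in \<Omega>. mixing_time 1 X M \<omega> = enat n \<bar> X 0 \<omega> = 1)"
  shows "(\<forall>\<rho>. stationary_distribution P \<rho> \<longleftrightarrow> \<rho> = vector [b / (1 - d), a / (1 - d)])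
    \<and> \<pi> $ 1 = b / (1 - d) \<and> \<pi> $ 2 = a / (1 - d)
    \<and> f 0 = \<pi> $ 1
    \<and> (\<forall>n\<ge>1. f n = \<pi> $ 2 * P $ 1 $ 2 * (P $ 1 $ 1) ^ (n - 1))
    \<and> g 0 = 0
    \<and> g 1 = \<pi> $ 1 * P $ 1 $ 1 + \<pi> $ 2 * P $ 1 $ 2
    \<and> (\<forall>n\<ge>2. g n = \<pi> $ 1 * (P $ 1 $ 1 * P $ 2 $ 2 - d) * (P $ 2 $ 2) ^ (n - 2)
                     + \<pi> $ 2 * P $ 1 $ 2 * (P $ 1 $ 1) ^ (n - 1))"
proof -
  interpret prob_space \<Omega> using assms(9) by (simp add: markov_chain_def)
  have X [measurable]: "X k \<in> measurable \<Omega> (count_space UNIV)" for k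
    using assms(9) by (simp add: markov_chain_def)
  have M [measurable]: "M \<in> measurable \<Omega> (count_space UNIV)"
    using assms(11) by (simp add: mixing_variable_def)
  have ne: "x \<noteq> 1 \<longleftrightarrow> x = 2" "x \<noteq> 2 \<longleftrightarrow> x = 1" for x :: 2
    using exhaust_2[of x] by auto
  have P: "P $ 1 $ 1 = 1 - a" "P $ 1 $ 2 = a" "P $ 2 $ 1 = b" "P $ 2 $ 2 = 1 - b"
    by (simp_all add: assms(5))
  have stat: "stationary_distribution P \<rho> \<longleftrightarrow> \<rho> = vector [b / (1 - d), a / (1 - d)]" for \<rho>
    using stationary_distribution_two_state[OF assms(1,3) _ assms(5)] assms(6,8) by simp
  then have \<pi>: "\<pi> $ 1 = b / (1 - d)" "\<pi> $ 2 = a / (1 - d)"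
    using assms(10) by simp_all
  define E where "E j n i = {\<omega>\<in>space \<Omega>. M \<omega> = j \<and> (\<forall>k\<le>n. X k \<omega> = i k)}" for j n i
  define w where "w n i = (\<Prod>k<n. P $ i k $ i (Suc k))" for n and i :: "nat \<Rightarrow> 2"
  let ?q = "\<P>(\<omega> in \<Omega>. X 0 \<omega> = 1)"
  have E_sets: "E j n i \<in> sets \<Omega>" for j n i
    unfolding E_def by measurable
  \<comment> \<open>Since the path starts in 1, dividing by \<open>?q\<close> cancels the initial
    factor.\<close>
  have E: "prob (E j n i) / ?q = \<pi> $ j * w n i" if "i 0 = 1" for j n i
    using that assms(12) mixing_variable_path_prob[OF prob_space_axioms assms(11), of j n i]
      markov_chain_path_prob[OF assms(9), of n i] by (simp add: E_def w_def)
  \<comment> \<open>The only paths from 1 that can produce the value \<open>n \<ge> 1\<close>: for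
    \<open>M = 2\<close>, \<open>?p n\<close> waits in 1 and jumps to 2 at time \<open>n\<close>;
    for \<open>M = 1\<close>, \<open>?r n\<close> leaves at once, waits in 2 and is back in 1 at
    time \<open>n\<close>.\<close>
  let ?p = "\<lambda>n k. if k < n then 1 else (2::2)"
  let ?r = "\<lambda>n k. if k = 0 \<or> k = n then 1 else (2::2)"
  \<comment> \<open>At \<open>n = 1\<close> there is no waiting and the power is an empty product,
    equal to 1 even if \<open>P $ 1 $ 1 = 0\<close>.\<close>
  have wp: "w n (?p n) = P $ 1 $ 2 * (P $ 1 $ 1) ^ (n - 1)" if "n \<ge> 1" for n
    using that by (cases n) (simp_all add: w_def)
  \<comment> \<open>At \<open>n = 1\<close> the return path never visits 2, so this case falls
    outside the general formula.\<close>
  have wr1: "w 1 (?r 1) = P $ 1 $ 1"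
    by (simp add: w_def)
  have wr: "w n (?r n) = (P $ 1 $ 1 * P $ 2 $ 2 - d) * (P $ 2 $ 2) ^ (n - 2)" if "n \<ge> 2" for n
  proof -
    obtain m where n: "n = Suc (Suc m)"
      using le_Suc_ex[OF \<open>2 \<le> n\<close>] by auto
    \<comment> \<open>The first and last transitions are peeled off; the \<open>m\<close> in between
      all stay in 2.\<close>
    have "w n (?r n) = P $ 1 $ 2 * (P $ 2 $ 2) ^ m * P $ 2 $ 1"
      unfolding w_def n by (subst prod.lessThan_Suc_shift) simp
    \<comment> \<open>This says that \<open>d\<close> is the determinant of
      \<open>P\<close>.\<close>
    moreover have "P $ 1 $ 1 * P $ 2 $ 2 - d = P $ 1 $ 2 * P $ 2 $ 1"
      by (simp add: P assms(6) algebra_simps)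
    ultimately show ?thesis
      by (simp add: n)
  qed
  \<comment> \<open>Both mixing times are treated at once: from state 1 with \<open>M = 2\<close>
    there is no hit at time 0, so starting the search at 0 or at 1 makes no difference.\<close>
  have hit2: "mixing_time k X M \<omega> = enat n \<and> X 0 \<omega> = 1 \<longleftrightarrow> (\<forall>m\<le>n. X m \<omega> = ?p n m)"
    if "M \<omega> = 2" "n \<ge> 1" "k \<le> 1" for k n \<omega>
  proof
    assume *: "mixing_time k X M \<omega> = enat n \<and> X 0 \<omega> = 1"
    show "\<forall>m\<le>n. X m \<omega> = ?p n m"
    proof (intro allI impI)
      fix m assume "m \<le> n"
      then consider "m = n" | "m = 0" "m < n" | "k \<le> m" "m < n"
        using \<open>k \<le> 1\<close> by linarith
      then show "X m \<omega> = ?p n m"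
        using * \<open>M \<omega> = 2\<close> by cases (simp_all add: mixing_time_eq_enat_iff ne)
    qed
  next
    assume "\<forall>m\<le>n. X m \<omega> = ?p n m"
    then show "mixing_time k X M \<omega> = enat n \<and> X 0 \<omega> = 1"
      using that by (simp add: mixing_time_eq_enat_iff)
  qed
  \<comment> \<open>Here the search has to start at 1: with \<open>M = 1\<close> time 0 is already a
    hit.\<close>
  have hit1: "mixing_time 1 X M \<omega> = enat n \<and> X 0 \<omega> = 1 \<longleftrightarrow> (\<forall>m\<le>n. X m \<omega> = ?r n m)"
    if "M \<omega> = 1" "n \<ge> 1" for n \<omega>
  proof
    assume *: "mixing_time 1 X M \<omega> = enat n \<and> X 0 \<omega> = 1"
    show "\<forall>m\<le>n. X m \<omega> = ?r n m"
    proof (intro allI impI)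
      fix m assume "m \<le> n"
      then consider "m = n" | "m = 0" | "1 \<le> m" "m < n"
        by linarith
      then show "X m \<omega> = ?r n m"
        using * \<open>M \<omega> = 1\<close> by cases (simp_all add: mixing_time_eq_enat_iff ne)
    qed
  next
    assume "\<forall>m\<le>n. X m \<omega> = ?r n m"
    then show "mixing_time 1 X M \<omega> = enat n \<and> X 0 \<omega> = 1"
      using that by (simp add: mixing_time_eq_enat_iff)
  qed
  have f0: "f 0 = \<pi> $ 1"
  proof -
    have "{\<omega>\<in>space \<Omega>. mixing_time 0 X M \<omega> = enat 0 \<and> X 0 \<omega> = 1} = E 1 0 (\<lambda>_. 1)"
      unfolding E_def mixing_time_eq_enat_iff by (rule Collect_cong) auto
    then show ?thesis
      using E[of "\<lambda>_. 1" 1 0] by (simp add: assms(13) cond_prob_def w_def)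
  qed
  have fn: "f n = \<pi> $ 2 * P $ 1 $ 2 * (P $ 1 $ 1) ^ (n - 1)" if "n \<ge> 1" for n
  proof -
    \<comment> \<open>If \<open>M\<close> were 1, the chain would meet it at time 0, before
      \<open>n\<close>. Hence \<open>f n\<close> has a single term.\<close>
    have "M \<omega> = 2" if "mixing_time 0 X M \<omega> = enat n \<and> X 0 \<omega> = 1" for \<omega>
    proof (rule ccontr)
      assume "M \<omega> \<noteq> 2"
      then have "M \<omega> = 1" by (simp add: ne)
      with that \<open>n \<ge> 1\<close> show False
        by (auto simp: mixing_time_eq_enat_iff Suc_le_eq)
    qed
    then have "mixing_time 0 X M \<omega> = enat n \<and> X 0 \<omega> = 1 \<longleftrightarrow>
        M \<omega> = 2 \<and> (\<forall>m\<le>n. X m \<omega> = ?p n m)" for \<omega>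
      using hit2[OF _ that, of \<omega> 0] by blast
    then have "{\<omega>\<in>space \<Omega>. mixing_time 0 X M \<omega> = enat n \<and> X 0 \<omega> = 1} = E 2 n (?p n)"
      by (simp only: E_def)
    then have "f n = prob (E 2 n (?p n)) / ?q"
      by (simp only: assms(13) cond_prob_def)
    also have "\<dots> = \<pi> $ 2 * w n (?p n)"
      using that by (intro E) simp
    finally show ?thesis
      by (simp only: wp[OF that] mult.assoc)
  qed
  have g0: "g 0 = 0"
    by (simp add: assms(14) cond_prob_def mixing_time_eq_enat_iff)
  have gn: "g n = \<pi> $ 1 * w n (?r n) + \<pi> $ 2 * w n (?p n)" if "n \<ge> 1" for n
  proof -
    \<comment> \<open>Now both values of \<open>M\<close> contribute one cylinder each, and these
      are disjoint because they fix different values of \<open>M\<close>; this gives the two terms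
      of \<open>g n\<close>.\<close>
    have "mixing_time 1 X M \<omega> = enat n \<and> X 0 \<omega> = 1 \<longleftrightarrow>
        M \<omega> = 1 \<and> (\<forall>m\<le>n. X m \<omega> = ?r n m) \<or> M \<omega> = 2 \<and> (\<forall>m\<le>n. X m \<omega> = ?p n m)" for \<omega>
      using exhaust_2[of "M \<omega>"]
    proof
      assume M1: "M \<omega> = 1"
      show ?thesis by (simp only: hit1[OF M1 that] M1) simp
    next
      assume M2: "M \<omega> = 2"
      show ?thesis by (simp only: hit2[OF M2 that order_refl] M2) simp
    qed
    then have "{\<omega>\<in>space \<Omega>. mixing_time 1 X M \<omega> = enat n \<and> X 0 \<omega> = 1} = E 1 n (?r n) \<union> E 2 n (?p n)"
      unfolding E_def by blast
    moreover have "prob (E 1 n (?r n) \<union> E 2 n (?p n)) = prob (E 1 n (?r n)) + prob (E 2 n (?p n))"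
      by (intro finite_measure_Union E_sets) (auto simp: E_def)
    moreover have "prob (E 1 n (?r n)) / ?q = \<pi> $ 1 * w n (?r n)"
      by (intro E) simp
    moreover have "prob (E 2 n (?p n)) / ?q = \<pi> $ 2 * w n (?p n)"
      using that by (intro E) simp
    ultimately show ?thesis
      by (simp only: assms(14) cond_prob_def add_divide_distrib)
  qed
  have g1: "g 1 = \<pi> $ 1 * P $ 1 $ 1 + \<pi> $ 2 * P $ 1 $ 2"
    using gn[of 1] wp[of 1] wr1 by simp
  have "g n = \<pi> $ 1 * (P $ 1 $ 1 * P $ 2 $ 2 - d) * (P $ 2 $ 2) ^ (n - 2)
      + \<pi> $ 2 * P $ 1 $ 2 * (P $ 1 $ 1) ^ (n - 1)" if "n \<ge> 2" for n
    using gn[of n] wp[of n] wr[of n] that by (simp add: mult.assoc)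
  with stat \<pi> f0 fn g0 g1 show ?thesis by blast
qed

end
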